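(* The recurrence coefficients $\alpha_n$ and $\beta_n$ are related to $r_n(t)$, $r_{n+1}(t)$, $R_{n-1}(t)$ and $R_n(t)$ as follows: $$\beta_n'(t)=\frac{\beta_n}{2}\left(R_{n-1}(t)-R_n(t)\right)$$ and $$\alpha_n'(t)=\frac12\left(r_n(t)-r_{n+1}(t)+1\right),$$ where $'$ denotes $d/dt$.
   Context: Let $A\ge 0$, $A+B\ge 0$, $\gamma>-1$. For $t\in\mathbb{R}$ let $w(z)=w(z,t,\gamma)=e^{-z^2+tz}|z-t|^{\gamma}(A+B\theta(z-t))$ for $z\in\mathbb{R}$, where $\theta(x)=1$ for $x>0$ and $\theta(x)=0$ for $x\le 0$. Let $P_n(z)=P_n(z,t,\gamma)$ be the monic polynomials of degree $n$ orthogonal with respect to $w$: $\int_{\mathbb{R}}P_jP_i\,w\,dz=h_j\delta_{ij}$, with $h_n=h_n(t)$. They satisfy the recurrence $zP_n(z)=P_{n+1}(z)+\alpha_nP_n(z)+\beta_nP_{n-1}(z)$, $n\ge0$, with $P_0:=1$, $\beta_0P_{-1}:=0$; this defines $\alpha_n=\alpha_n(t)$ and $\beta_n=\beta_n(t)=h_n/h_{n-1}$. Define $$R_n(t)=\frac{\gamma}{h_n}\int_{\mathbb{R}}\frac{P_n^2(y)w(y)}{y-t}\,dy,\qquad r_n(t)=\frac{\gamma}{h_{n-1}}\int_{\mathbb{R}}\frac{P_n(y)P_{n-1}(y)w(y)}{y-t}\,dy.$$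
   Formalization: For -1<γ≤0 the integrals defining R_n and r_n generally diverge; there γ∫ is read as the finite part lim_{e→0+}[γ∫_{|y-t|>e} + B e^γ p(t)], p being P_n² or P_nP_{n-1}. The zero weight A=B=0 is excluded, β_n is taken for n≥1, and r_0=0. *)

theory Defs
  imports "HOL-Analysis.Analysis" "HOL-Computational_Algebra.Polynomial"
begin

definition step :: "real \<Rightarrow> real" where
  "step x = (if x > 0 then 1 else 0)"

definition weight :: "real \<Rightarrow> real \<Rightarrow> real \<Rightarrow> real \<Rightarrow> real \<Rightarrow> real" where
  "weight A B \<gamma> t z =
     exp (- z\<^sup>2 + t * z) * \<bar>z - t\<bar> powr \<gamma> * (A + B * step (z - t))"

definition monic_orthogonal :: "(real \<Rightarrow> real) \<Rightarrow> (nat \<Rightarrow> real poly) \<Rightarrow> bool" where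
  "monic_orthogonal w P \<longleftrightarrow>
     (\<forall>n. degree (P n) = n \<and> lead_coeff (P n) = 1) \<and>
     (\<forall>i j. i \<noteq> j \<longrightarrow> (LINT z|lborel. poly (P j) z * poly (P i) z * w z) = 0)"

definition sq_norm :: "(real \<Rightarrow> real) \<Rightarrow> (nat \<Rightarrow> real poly) \<Rightarrow> nat \<Rightarrow> real" where
  "sq_norm w P n = (LINT z|lborel. (poly (P n) z)\<^sup>2 * w z)"

text \<open>
  The recurrence holds for all \<open>n \<ge> 0\<close>; at \<open>n = 0\<close> the last term is absent, so \<open>b 0\<close> is
  unconstrained. For a nonzero weight the recurrence determines \<open>a n\<close> for \<open>n \<ge> 0\<close> and
  \<open>b n = sq_norm w P n / sq_norm w P (n - 1)\<close> for \<open>n \<ge> 1\<close>.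
\<close>
definition three_term_recurrence ::
    "(nat \<Rightarrow> real poly) \<Rightarrow> (nat \<Rightarrow> real) \<Rightarrow> (nat \<Rightarrow> real) \<Rightarrow> bool" where
  "three_term_recurrence P a b \<longleftrightarrow>
     (\<forall>n. [:0, 1:] * P n = P (Suc n) + smult (a n) (P n)
            + (if n = 0 then 0 else smult (b n) (P (n - 1))))"

text \<open>
  \<open>singular_integral A B \<gamma> t p\<close> is \<open>\<gamma> \<integral> p(y) w(y) / (y - t) dy\<close> for the weight \<open>w\<close> above.
  For \<open>\<gamma> > 0\<close> this is an absolutely convergent Lebesgue integral. For \<open>-1 < \<gamma> \<le> 0\<close> it diverges
  unless \<open>p(t) = 0\<close>, and the product with \<open>\<gamma>\<close> is understood by analytic continuation from
  \<open>\<gamma> > 0\<close>. With \<open>g(y) = p(y) exp(-y^2 + t y)\<close>, so \<open>g(t) = p(t)\<close>, the truncated integral behaves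
  as \<open>\<gamma> \<integral>\<close> (over \<open>y > t + e\<close>) \<open>= -(A + B) e^\<gamma> p(t) + const + o(1)\<close> and
  \<open>\<gamma> \<integral>\<close> (over \<open>y < t - e\<close>) \<open>= A e^\<gamma> p(t) + const + o(1)\<close>, so adding \<open>B e^\<gamma> p(t)\<close> leaves the
  finite part: the Hadamard finite part if \<open>\<gamma> < 0\<close> (the principal value if \<open>B = 0\<close>), and the
  jump contribution \<open>B p(t)\<close> if \<open>\<gamma> = 0\<close>. For \<open>\<gamma> > 0\<close> the added term tends to 0, so the limit
  would also give the ordinary integral.
\<close>
definition singular_integral ::
    "real \<Rightarrow> real \<Rightarrow> real \<Rightarrow> real \<Rightarrow> real poly \<Rightarrow> real" where
  "singular_integral A B \<gamma> t p =
     (if \<gamma> > 0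
      then \<gamma> * (LINT y|lborel. poly p y * weight A B \<gamma> t y / (y - t))
      else Lim (at_right 0) (\<lambda>e.
             \<gamma> * (LINT y:{y. \<bar>y - t\<bar> > e}|lborel. poly p y * weight A B \<gamma> t y / (y - t))
             + B * e powr \<gamma> * poly p t))"

definition R_aux ::
    "real \<Rightarrow> real \<Rightarrow> real \<Rightarrow> (real \<Rightarrow> nat \<Rightarrow> real poly) \<Rightarrow> nat \<Rightarrow> real \<Rightarrow> real" where
  "R_aux A B \<gamma> P n t =
     singular_integral A B \<gamma> t ((P t n)\<^sup>2) / sq_norm (weight A B \<gamma> t) (P t) n"

text \<open>At \<open>n = 0\<close> the convention that terms containing \<open>P\<^sub>-\<^sub>1\<close> vanish gives \<open>r\<^sub>0 = 0\<close>.\<close>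
definition r_aux ::
    "real \<Rightarrow> real \<Rightarrow> real \<Rightarrow> (real \<Rightarrow> nat \<Rightarrow> real poly) \<Rightarrow> nat \<Rightarrow> real \<Rightarrow> real" where
  "r_aux A B \<gamma> P n t =
     (if n = 0 then 0
      else singular_integral A B \<gamma> t (P t n * P t (n - 1))
             / sq_norm (weight A B \<gamma> t) (P t) (n - 1))"

end

theory Submission
  imports Defs "HOL-Real_Asymp.Real_Asymp"
begin

text \<open>
  Translating by \<open>t\<close> turns the weight into \<open>exp (- x\<^sup>2 - t x) \<bar>x\<bar>\<^sup>\<gamma> (A + B \<theta>(x))\<close>, which is smooth in \<open>t\<close>.
  Writing \<open>L p = \<integral> p w\<close>, dominated convergence gives \<open>d/dt L p = L (p' + (t - z) p)\<close> for fixed \<open>p\<close>, and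
  integration by parts off the singularity gives \<open>L ((2 z - t) p - p')\<close> for the regularised integral
  \<open>\<gamma> \<integral> p w / (z - t)\<close>. Applied to \<open>P\<^sub>n\<^sup>2\<close> and \<open>P\<^sub>n P\<^sub>n\<^sub>-\<^sub>1\<close>, orthogonality yields
  \<open>R\<^sub>n = 2 \<alpha>\<^sub>n - t\<close> and \<open>r\<^sub>n = 2 \<beta>\<^sub>n - n\<close>, while differentiating \<open>h\<^sub>n\<close> and the relation
  \<open>L (P\<^sub>n P\<^sub>n\<^sub>-\<^sub>1) = 0\<close> yields \<open>h\<^sub>n' = (t - \<alpha>\<^sub>n) h\<^sub>n\<close> and \<open>p\<^sub>n' = \<beta>\<^sub>n - n\<close>, where \<open>p\<^sub>n\<close> is the
  subleading coefficient of \<open>P\<^sub>n\<close> and \<open>\<alpha>\<^sub>n = p\<^sub>n - p\<^sub>n\<^sub>+\<^sub>1\<close>.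
\<close>

section \<open>Integrals and derivatives\<close>

lemma has_real_derivative_integral:
  fixes f :: "real \<Rightarrow> 'a \<Rightarrow> real"
  assumes f: "\<And>s. \<bar>s - t\<bar> < d \<Longrightarrow> integrable M (f s)" and d: "0 < d"
    and f': "\<And>s x. \<bar>s - t\<bar> < d \<Longrightarrow> x \<in> space M \<Longrightarrow> ((\<lambda>s. f s x) has_real_derivative f' s x) (at s)"
    and bound: "\<And>s x. \<bar>s - t\<bar> < d \<Longrightarrow> x \<in> space M \<Longrightarrow> \<bar>f' s x\<bar> \<le> g x"
    and g: "integrable M g" and meas: "f' t \<in> borel_measurable M"
  shows "((\<lambda>s. LINT x|M. f s x) has_real_derivative (LINT x|M. f' t x)) (at t)"
proof -
  have "((\<lambda>s. ((LINT x|M. f s x) - (LINT x|M. f t x)) / (s - t)) \<longlongrightarrow> (LINT x|M. f' t x)) (at t within {t-d<..<t+d})"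
    unfolding tendsto_at_iff_sequentially
  proof (intro allI impI)
    fix X :: "nat \<Rightarrow> real"
    assume "\<forall>i. X i \<in> {t - d<..<t + d} - {t}" and lim: "X \<longlonglongrightarrow> t"
    then have X: "\<bar>X i - t\<bar> < d" "X i \<noteq> t" for i by (auto simp: abs_less_iff algebra_simps)
    have int: "integrable M (\<lambda>x. (f (X i) x - f t x) / (X i - t))" for i
      using f X d by auto
    have "(\<lambda>i. LINT x|M. (f (X i) x - f t x) / (X i - t)) \<longlonglongrightarrow> (LINT x|M. f' t x)"
    proof (rule integral_dominated_convergence[OF meas _ g])
      show "(\<lambda>x. (f (X i) x - f t x) / (X i - t)) \<in> borel_measurable M" for i
        using int by (rule borel_measurable_integrable)
      show "AE x in M. (\<lambda>i. (f (X i) x - f t x) / (X i - t)) \<longlonglongrightarrow> f' t x"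
      proof (rule AE_I2)
        fix x assume x: "x \<in> space M"
        have "((\<lambda>s. (f s x - f t x) / (s - t)) \<longlongrightarrow> f' t x) (at t)"
          using f'[of t x] d x by (simp add: has_field_derivative_iff)
        then show "(\<lambda>i. (f (X i) x - f t x) / (X i - t)) \<longlonglongrightarrow> f' t x"
          using X lim unfolding tendsto_at_iff_sequentially by (auto simp: comp_def)
      qed
      show "AE x in M. norm ((f (X i) x - f t x) / (X i - t)) \<le> g x" for i
      proof (rule AE_I2)
        fix x assume x: "x \<in> space M"
        have "norm (f (X i) x - f t x) \<le> g x * norm (X i - t)"
        proof (rule field_differentiable_bound[of "{t-d<..<t+d}" "\<lambda>s. f s x" "\<lambda>s. f' s x"])
          show "((\<lambda>s. f s x) has_field_derivative f' s x) (at s within {t-d<..<t+d})" if "s \<in> {t-d<..<t+d}" for s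
            by (rule has_field_derivative_at_within, rule f'[OF _ x]) (use that in auto)
          show "norm (f' s x) \<le> g x" if "s \<in> {t-d<..<t+d}" for s
            using bound[OF _ x, of s] that by auto
        qed (use X(1)[of i] d in \<open>auto simp: abs_less_iff\<close>)
        then show "norm ((f (X i) x - f t x) / (X i - t)) \<le> g x"
          using X(2)[of i] by (simp add: divide_simps)
      qed
    qed
    moreover have "(LINT x|M. f (X i) x - f t x) = (LINT x|M. f (X i) x) - (LINT x|M. f t x)" for i
      by (rule Bochner_Integration.integral_diff) (use f X d in auto)
    ultimately show "((\<lambda>s. ((LINT x|M. f s x) - (LINT x|M. f t x)) / (s - t)) \<circ> X) \<longlonglongrightarrow> (LINT x|M. f' t x)"
      by (simp add: comp_def)
  qed
  then show ?thesis
    unfolding has_field_derivative_iff using d by (subst (asm) at_within_open) auto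
qed

lemma poly_exp_bound:
  fixes p :: "real poly"
  shows "\<exists>K\<ge>0. \<forall>y. \<bar>poly p y\<bar> * exp (- y\<^sup>2 + b * \<bar>y\<bar>) \<le> K"
proof (induction p arbitrary: b)
  case 0
  show ?case by (intro exI[of _ 0]) auto
next
  case (pCons a p)
  obtain K where K: "K \<ge> 0" "\<And>y. \<bar>poly p y\<bar> * exp (- y\<^sup>2 + (b + 1) * \<bar>y\<bar>) \<le> K"
    using pCons.IH[of "b + 1"] by auto
  show ?case
  proof (intro exI[of _ "\<bar>a\<bar> * exp (b\<^sup>2 / 4) + K"] conjI allI)
    fix y :: real
    have "0 \<le> (\<bar>y\<bar> - b / 2)\<^sup>2" by simp
    then have "- y\<^sup>2 + b * \<bar>y\<bar> \<le> b\<^sup>2 / 4" by (simp add: power2_eq_square algebra_simps)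
    then have 1: "\<bar>a\<bar> * exp (- y\<^sup>2 + b * \<bar>y\<bar>) \<le> \<bar>a\<bar> * exp (b\<^sup>2 / 4)"
      by (intro mult_left_mono) auto
    have "\<bar>y\<bar> \<le> exp \<bar>y\<bar>" using exp_ge_add_one_self[of "\<bar>y\<bar>"] by linarith
    then have "\<bar>y\<bar> * (\<bar>poly p y\<bar> * exp (- y\<^sup>2 + b * \<bar>y\<bar>)) \<le> exp \<bar>y\<bar> * (\<bar>poly p y\<bar> * exp (- y\<^sup>2 + b * \<bar>y\<bar>))"
      by (intro mult_right_mono) auto
    also have "\<dots> = \<bar>poly p y\<bar> * exp (- y\<^sup>2 + (b + 1) * \<bar>y\<bar>)"
      by (simp add: exp_add[symmetric] algebra_simps)
    finally have 2: "\<bar>y\<bar> * (\<bar>poly p y\<bar> * exp (- y\<^sup>2 + b * \<bar>y\<bar>)) \<le> K" using K(2)[of y] by simp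
    have "\<bar>poly (pCons a p) y\<bar> \<le> \<bar>a\<bar> + \<bar>y\<bar> * \<bar>poly p y\<bar>"
      using abs_triangle_ineq[of a "y * poly p y"] by (simp add: abs_mult)
    then have "\<bar>poly (pCons a p) y\<bar> * exp (- y\<^sup>2 + b * \<bar>y\<bar>) \<le> (\<bar>a\<bar> + \<bar>y\<bar> * \<bar>poly p y\<bar>) * exp (- y\<^sup>2 + b * \<bar>y\<bar>)"
      by (intro mult_right_mono) auto
    also have "\<dots> \<le> \<bar>a\<bar> * exp (b\<^sup>2 / 4) + K" using 1 2 by (simp add: distrib_right mult.assoc)
    finally show "\<bar>poly (pCons a p) y\<bar> * exp (- y\<^sup>2 + b * \<bar>y\<bar>) \<le> \<bar>a\<bar> * exp (b\<^sup>2 / 4) + K" .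
  qed (use K in auto)
qed

lemma poly_shift_exp_bound:
  fixes p :: "real poly"
  assumes "b \<ge> 0"
  shows "\<exists>K\<ge>0. \<forall>s x. \<bar>s\<bar> \<le> T \<longrightarrow> \<bar>poly p (x + s)\<bar> * exp (- x\<^sup>2 - s * x) \<le> K * exp (- b * \<bar>x\<bar>)"
proof -
  obtain K where K: "K \<ge> 0" "\<And>y. \<bar>poly p y\<bar> * exp (- y\<^sup>2 + (T + b) * \<bar>y\<bar>) \<le> K"
    using poly_exp_bound[of p "T + b"] by auto
  show ?thesis
  proof (intro exI[of _ "K * exp (b * T)"] conjI allI impI)
    fix s x :: real assume s: "\<bar>s\<bar> \<le> T"
    define y where "y = x + s"
    have "s * y \<le> \<bar>s\<bar> * \<bar>y\<bar>" by (simp add: abs_mult[symmetric])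
    then have "s * y \<le> T * \<bar>y\<bar>" using mult_right_mono[OF s, of "\<bar>y\<bar>"] by simp
    moreover have "b * \<bar>x\<bar> \<le> b * (\<bar>y\<bar> + T)"
      using s assms by (intro mult_left_mono) (auto simp: y_def)
    moreover have "- x\<^sup>2 - s * x = - y\<^sup>2 + s * y" by (simp add: y_def power2_eq_square algebra_simps)
    ultimately have "- x\<^sup>2 - s * x \<le> (- y\<^sup>2 + (T + b) * \<bar>y\<bar>) + (b * T - b * \<bar>x\<bar>)"
      by (simp add: algebra_simps)
    then have "exp (- x\<^sup>2 - s * x) \<le> exp (- y\<^sup>2 + (T + b) * \<bar>y\<bar>) * exp (b * T - b * \<bar>x\<bar>)"
      by (simp add: exp_add[symmetric])
    then have "\<bar>poly p y\<bar> * exp (- x\<^sup>2 - s * x) \<le> \<bar>poly p y\<bar> * (exp (- y\<^sup>2 + (T + b) * \<bar>y\<bar>) * exp (b * T - b * \<bar>x\<bar>))"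
      by (intro mult_left_mono) auto
    also have "\<dots> \<le> K * exp (b * T - b * \<bar>x\<bar>)"
      using mult_right_mono[OF K(2)[of y], of "exp (b * T - b * \<bar>x\<bar>)"] by (simp add: mult.assoc)
    also have "\<dots> = K * exp (b * T) * exp (- b * \<bar>x\<bar>)" by (simp add: exp_diff exp_minus field_simps)
    finally show "\<bar>poly p (x + s)\<bar> * exp (- x\<^sup>2 - s * x) \<le> K * exp (b * T) * exp (- b * \<bar>x\<bar>)"
      by (simp add: y_def)
  qed (use K in auto)
qed

lemma integrable_exp_abs_powr:
  assumes "\<gamma> > -1"
  shows "integrable lborel (\<lambda>x::real. exp (- \<bar>x\<bar>) * \<bar>x\<bar> powr \<gamma>)"
proof -
  let ?f = "\<lambda>x::real. indicator {0..} x *\<^sub>R (\<bar>x\<bar> powr \<gamma> / exp \<bar>x\<bar>)"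
  have "(\<lambda>x::real. x powr \<gamma> / exp x) absolutely_integrable_on {0..}"
    using Gamma_integral_real[of "\<gamma> + 1"] assms
    by (intro nonnegative_absolutely_integrable_1) (auto simp: has_integral_integrable)
  then have "set_integrable lborel {0..} (\<lambda>x::real. x powr \<gamma> / exp x)"
    unfolding absolutely_integrable_on_def set_integrable_def
    by (subst (asm) integrable_completion) auto
  then have 1: "integrable lborel ?f"
    unfolding set_integrable_def by (rule Bochner_Integration.integrable_cong[THEN iffD1, rotated 2]) (auto simp: indicator_def)
  have 2: "integrable lborel (\<lambda>x. ?f (0 + (-1) * x))"
    by (rule lborel_integrable_real_affine[OF 1]) simp
  have "integrable lborel (\<lambda>x. ?f x + ?f (0 + (-1) * x))" using 1 2 by (rule Bochner_Integration.integrable_add)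
  then show ?thesis
    by (rule Bochner_Integration.integrable_cong[THEN iffD1, rotated 2])
       (auto simp: indicator_def exp_minus field_simps)
qed

lemma has_real_derivative_abs_powr:
  assumes "x \<noteq> 0"
  shows "((\<lambda>x::real. \<bar>x\<bar> powr a) has_real_derivative a * \<bar>x\<bar> powr a / x) (at x)"
proof (cases "x > 0")
  case True
  have "((\<lambda>x::real. x powr a) has_real_derivative a * x powr (a - 1)) (at x)"
    using True by (rule has_real_derivative_powr)
  moreover have "\<forall>\<^sub>F y in nhds x. \<bar>y\<bar> powr a = y powr a"
    using eventually_nhds_in_open[of "{0<..}" x] True by (auto elim!: eventually_mono)
  ultimately show ?thesis using True
    by (subst DERIV_cong_ev[OF refl _ refl]) (auto simp: powr_diff)
next
  case False
  then have x: "x < 0" using assms by simp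
  have "((\<lambda>x::real. (- x) powr a) has_real_derivative a * (- x) powr (a - 1) * (- 1)) (at x)"
    using x by (auto intro!: derivative_eq_intros simp: field_simps powr_diff)
  moreover have "\<forall>\<^sub>F y in nhds x. \<bar>y\<bar> powr a = (- y) powr a"
    using eventually_nhds_in_open[of "{..<0}" x] x by (auto elim!: eventually_mono)
  ultimately show ?thesis using x
    by (subst DERIV_cong_ev[OF refl _ refl]) (auto simp: powr_diff field_simps)
qed

lemma truncated_integral_tendsto:
  fixes f :: "real \<Rightarrow> real"
  assumes "integrable lborel f"
  shows "((\<lambda>e. LINT x|lborel. indicator {x. \<bar>x\<bar> > e} x * f x) \<longlongrightarrow> (LINT x|lborel. f x)) (at_right 0)"
  unfolding filterlim_at_right_to_top
proof (rule integral_dominated_convergence_at_top[where w = "\<lambda>x. \<bar>f x\<bar>"])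
  have "(\<lambda>x. indicator {x. \<bar>x\<bar> > inverse s} x * f x) \<in> borel_measurable lborel" for s :: real
    using assms by measurable
  then show "\<And>s. (\<lambda>x. indicator {x. \<bar>x\<bar> > inverse s} x * f x) \<in> borel_measurable lborel" .
  show "AE x in lborel. ((\<lambda>s. indicator {x. \<bar>x\<bar> > inverse s} x * f x) \<longlongrightarrow> f x) at_top"
    using AE_lborel_singleton[of 0]
  proof eventually_elim
    case (elim x)
    have "(inverse \<longlongrightarrow> (0::real)) at_top" by (rule tendsto_inverse_0_at_top) (rule filterlim_ident)
    then have "\<forall>\<^sub>F s in at_top. inverse s < \<bar>x\<bar>"
      using elim by (intro order_tendstoD) auto
    then show ?case
      by (intro tendsto_eventually, elim eventually_mono) simp
  qed
  show "\<forall>\<^sub>F s in at_top. AE x in lborel. norm (indicator {x. \<bar>x\<bar> > inverse s} x * f x) \<le> \<bar>f x\<bar>"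
    by (intro always_eventually allI AE_I2) (auto simp: indicator_def)
qed (use assms in auto)

section \<open>Integration of polynomials against the weight\<close>

lemma step_measurable [measurable]: "step \<in> borel_measurable borel"
  unfolding step_def by measurable

lemma poly_measurable [measurable]: "poly (p :: real poly) \<in> borel_measurable borel"
  by (intro borel_measurable_continuous_onI continuous_intros)

locale jump_weight =
  fixes A B \<gamma> :: real
  assumes A_nonneg: "A \<ge> 0" and AB_nonneg: "A + B \<ge> 0" and AB_nonzero: "\<not> (A = 0 \<and> B = 0)"
    and gamma: "\<gamma> > -1"
begin

definition singular_part :: "real \<Rightarrow> real" where
  "singular_part x = \<bar>x\<bar> powr \<gamma> * (A + B * step x)"

definition L :: "real \<Rightarrow> real poly \<Rightarrow> real" where
  "L t p = (LINT z|lborel. poly p z * weight A B \<gamma> t z)"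

lemma singular_part_measurable [measurable]: "singular_part \<in> borel_measurable borel"
  unfolding singular_part_def by measurable

lemma weight_nonneg: "weight A B \<gamma> t z \<ge> 0"
  using A_nonneg AB_nonneg by (auto simp: weight_def step_def)

lemma singular_part_bound: "\<bar>singular_part x\<bar> \<le> (A + \<bar>B\<bar>) * \<bar>x\<bar> powr \<gamma>"
proof -
  have "\<bar>A + B * step x\<bar> \<le> A + \<bar>B\<bar>" using A_nonneg by (auto simp: step_def)
  then show ?thesis
    unfolding singular_part_def abs_mult by (subst mult.commute) (auto intro!: mult_right_mono)
qed

text \<open>After the translation the weight depends on \<open>t\<close> only through the entire factor
  \<open>exp (- x\<^sup>2 - t * x)\<close>, so the singularity no longer moves.\<close>

lemma weight_shift: "weight A B \<gamma> t (x + t) = exp (- x\<^sup>2 - t * x) * singular_part x"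
proof -
  have "- (x + t)\<^sup>2 + t * (x + t) = - x\<^sup>2 - t * x" by (simp add: power2_eq_square algebra_simps)
  then show ?thesis by (simp add: weight_def singular_part_def)
qed

lemma L_shift: "L t p = (LINT x|lborel. poly p (x + t) * exp (- x\<^sup>2 - t * x) * singular_part x)"
  unfolding L_def by (subst lborel_integral_real_affine[of 1 _ t]) (auto simp: weight_shift add.commute mult.assoc)

lemma envelope:
  assumes "\<bar>f\<bar> \<le> K * exp (- \<bar>x\<bar>)"
  shows "\<bar>f * singular_part x\<bar> \<le> K * (A + \<bar>B\<bar>) * (exp (- \<bar>x\<bar>) * \<bar>x\<bar> powr \<gamma>)"
proof -
  have "\<bar>f * singular_part x\<bar> \<le> (K * exp (- \<bar>x\<bar>)) * ((A + \<bar>B\<bar>) * \<bar>x\<bar> powr \<gamma>)"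
    unfolding abs_mult using assms singular_part_bound[of x] by (intro mult_mono) auto
  then show ?thesis by (simp add: algebra_simps)
qed

lemma integrable_envelope: "integrable lborel (\<lambda>x. c * (exp (- \<bar>x\<bar>) * \<bar>x\<bar> powr \<gamma>))"
  using integrable_exp_abs_powr[OF gamma] by simp

lemma integrable_shift: "integrable lborel (\<lambda>x. poly p (x + t) * exp (- x\<^sup>2 - t * x) * singular_part x)"
proof -
  obtain K where K: "\<And>x. \<bar>poly p (x + t)\<bar> * exp (- x\<^sup>2 - t * x) \<le> K * exp (- \<bar>x\<bar>)"
    using poly_shift_exp_bound[of 1 "\<bar>t\<bar>" p] by auto
  show ?thesis
  proof (rule Bochner_Integration.integrable_bound[OF integrable_envelope[of "K * (A + \<bar>B\<bar>)"]])
    show "AE x in lborel. norm (poly p (x + t) * exp (- x\<^sup>2 - t * x) * singular_part x)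
        \<le> norm (K * (A + \<bar>B\<bar>) * (exp (- \<bar>x\<bar>) * \<bar>x\<bar> powr \<gamma>))"
    proof (rule AE_I2)
      fix x
      have "\<bar>poly p (x + t) * exp (- x\<^sup>2 - t * x)\<bar> \<le> K * exp (- \<bar>x\<bar>)" using K[of x] by (simp add: abs_mult)
      from order_trans[OF envelope[OF this] abs_ge_self] show "norm (poly p (x + t) * exp (- x\<^sup>2 - t * x) * singular_part x)
        \<le> norm (K * (A + \<bar>B\<bar>) * (exp (- \<bar>x\<bar>) * \<bar>x\<bar> powr \<gamma>))" by (simp only: real_norm_def)
    qed
  qed measurable
qed

lemma integrable_weight: "integrable lborel (\<lambda>z. poly p z * weight A B \<gamma> t z)"
  using integrable_shift[of p t] lborel_integrable_real_affine_iff[of 1 "\<lambda>z. poly p z * weight A B \<gamma> t z" t]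
  by (simp add: weight_shift add.commute mult.assoc)

lemma L_add: "L t (p + q) = L t p + L t q"
  unfolding L_def by (simp add: distrib_right Bochner_Integration.integral_add[OF integrable_weight integrable_weight])

lemma L_smult: "L t (smult c p) = c * L t p"
  unfolding L_def by (simp add: mult.assoc)

lemma L_minus: "L t (- p) = - L t p"
  using L_smult[of t "-1" p] by simp

lemma L_diff: "L t (p - q) = L t p - L t q"
  using L_add[of t p "- q"] by (simp add: L_minus)

lemma L_0 [simp]: "L t 0 = 0"
  by (simp add: L_def)

lemma L_sum: "L t (\<Sum>i\<in>I. f i) = (\<Sum>i\<in>I. L t (f i))"
  by (induction I rule: infinite_finite_induct) (auto simp: L_add)

lemmas L_linear = L_add L_diff L_minus L_smult

lemma L_square_pos:
  assumes "p \<noteq> 0"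
  shows "L t (p * p) > 0"
proof -
  define I where "I = (if A > 0 then {t - 1<..<t} else {t<..<t + 1})"
  have pos: "weight A B \<gamma> t z > 0" if "z \<in> I" for z
    using that A_nonneg AB_nonneg AB_nonzero by (auto simp: I_def weight_def step_def split: if_splits)
  have "\<not> (AE z in lborel. poly (p * p) z * weight A B \<gamma> t z = 0)"
  proof
    assume "AE z in lborel. poly (p * p) z * weight A B \<gamma> t z = 0"
    moreover have "AE z in lborel. z \<notin> {z. poly p z = 0}"
      using poly_roots_finite[OF assms] by (intro AE_not_in finite_imp_null_set_lborel)
    ultimately have "AE z in lborel. z \<notin> I"
      by eventually_elim (use pos in force)
    moreover have "I \<in> sets lborel" by (auto simp: I_def)
    ultimately have "emeasure lborel I = 0"
      by (simp add: AE_iff_null_sets null_setsD1)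
    then show False by (auto simp: I_def split: if_splits)
  qed
  moreover have "L t (p * p) \<ge> 0"
    unfolding L_def by (intro integral_nonneg_AE AE_I2 mult_nonneg_nonneg weight_nonneg) simp
  moreover have "L t (p * p) = 0 \<longleftrightarrow> (AE z in lborel. poly (p * p) z * weight A B \<gamma> t z = 0)"
    unfolding L_def by (intro integral_nonneg_eq_0_iff_AE integrable_weight AE_I2 mult_nonneg_nonneg weight_nonneg) simp
  ultimately show ?thesis by linarith
qed

lemma L_has_derivative:
  "((\<lambda>s. L s p) has_real_derivative L t (pderiv p + [:t, -1:] * p)) (at t)"
proof -
  let ?f = "\<lambda>s x. poly p (x + s) * exp (- x\<^sup>2 - s * x)"
  let ?f' = "\<lambda>s x. (poly (pderiv p) (x + s) - x * poly p (x + s)) * exp (- x\<^sup>2 - s * x)"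
  define T where "T = \<bar>t\<bar> + 1"
  obtain K1 where K1: "\<And>s x. \<bar>s\<bar> \<le> T \<Longrightarrow> \<bar>poly (pderiv p) (x + s)\<bar> * exp (- x\<^sup>2 - s * x) \<le> K1 * exp (- \<bar>x\<bar>)"
    using poly_shift_exp_bound[of 1 T "pderiv p"] by auto
  obtain K2 where K2: "K2 \<ge> 0" "\<And>s x. \<bar>s\<bar> \<le> T \<Longrightarrow> \<bar>poly p (x + s)\<bar> * exp (- x\<^sup>2 - s * x) \<le> K2 * exp (- 2 * \<bar>x\<bar>)"
    using poly_shift_exp_bound[of 2 T p] by auto
  have bound: "\<bar>?f' s x\<bar> \<le> (K1 + K2) * exp (- \<bar>x\<bar>)" if "\<bar>s\<bar> \<le> T" for s x
  proof -
    have "\<bar>x\<bar> \<le> exp \<bar>x\<bar>" using exp_ge_add_one_self[of "\<bar>x\<bar>"] by linarith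
    then have "\<bar>x\<bar> * (\<bar>poly p (x + s)\<bar> * exp (- x\<^sup>2 - s * x)) \<le> exp \<bar>x\<bar> * (K2 * exp (- 2 * \<bar>x\<bar>))"
      using K2(1) by (intro mult_mono[OF _ K2(2)[OF that]]) auto
    also have "\<dots> = K2 * exp (- \<bar>x\<bar>)" using exp_add[of "\<bar>x\<bar>" "- 2 * \<bar>x\<bar>"] by simp
    finally have "\<bar>x\<bar> * (\<bar>poly p (x + s)\<bar> * exp (- x\<^sup>2 - s * x)) \<le> K2 * exp (- \<bar>x\<bar>)" .
    moreover have "\<bar>poly (pderiv p) (x + s) - x * poly p (x + s)\<bar> \<le> \<bar>poly (pderiv p) (x + s)\<bar> + \<bar>x\<bar> * \<bar>poly p (x + s)\<bar>"
      using abs_triangle_ineq4[of "poly (pderiv p) (x + s)" "x * poly p (x + s)"] by (simp add: abs_mult)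
    then have "\<bar>?f' s x\<bar> \<le> (\<bar>poly (pderiv p) (x + s)\<bar> + \<bar>x\<bar> * \<bar>poly p (x + s)\<bar>) * exp (- x\<^sup>2 - s * x)"
      by (subst abs_mult) (simp add: mult_right_mono)
    ultimately show ?thesis using K1[OF that, of x] by (simp add: distrib_right mult.assoc)
  qed
  have "((\<lambda>s. LINT x|lborel. ?f s x * singular_part x) has_real_derivative
      (LINT x|lborel. ?f' t x * singular_part x)) (at t)"
  proof (rule has_real_derivative_integral[where d = 1])
    show "integrable lborel (\<lambda>x. ?f s x * singular_part x)" for s by (rule integrable_shift)
    show "((\<lambda>s. ?f s x * singular_part x) has_real_derivative ?f' s x * singular_part x) (at s)" for s x
      by (auto intro!: derivative_eq_intros DERIV_chain2[where f = "poly p", OF poly_DERIV] simp: algebra_simps)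
    show "\<bar>?f' s x * singular_part x\<bar> \<le> (K1 + K2) * (A + \<bar>B\<bar>) * (exp (- \<bar>x\<bar>) * \<bar>x\<bar> powr \<gamma>)"
      if "\<bar>s - t\<bar> < 1" for s x
      using that by (intro envelope bound) (auto simp: T_def)
    show "integrable lborel (\<lambda>x. (K1 + K2) * (A + \<bar>B\<bar>) * (exp (- \<bar>x\<bar>) * \<bar>x\<bar> powr \<gamma>))"
      by (rule integrable_envelope)
    show "(\<lambda>x. ?f' t x * singular_part x) \<in> borel_measurable lborel" by measurable
  qed simp
  moreover have "(LINT x|lborel. ?f' t x * singular_part x) = L t (pderiv p + [:t, -1:] * p)"
    unfolding L_shift by (intro Bochner_Integration.integral_cong refl) (simp add: algebra_simps)
  ultimately show ?thesis by (simp only: L_shift[of _ p])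
qed

subsection \<open>The singular integral\<close>

context
  fixes t :: real and p :: "real poly"
begin

definition "gaussian x = poly p (x + t) * exp (- x\<^sup>2 - t * x)"
definition "gaussian' x = (poly (pderiv p) (x + t) - (2 * x + t) * poly p (x + t)) * exp (- x\<^sup>2 - t * x)"

lemma gaussian_DERIV: "(gaussian has_real_derivative gaussian' x) (at x)"
  unfolding gaussian_def gaussian'_def
  by (auto intro!: derivative_eq_intros DERIV_chain2[where f = "poly p", OF poly_DERIV] simp: algebra_simps)

lemma gaussian_measurable [measurable]: "gaussian \<in> borel_measurable borel" "gaussian' \<in> borel_measurable borel"
  unfolding gaussian_def gaussian'_def by measurable

lemma gaussian_cont: "isCont gaussian x" "isCont gaussian' x"
  unfolding gaussian_def gaussian'_def by (auto intro!: continuous_intros isCont_o2[where g = "poly _"])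

definition "primitive x = gaussian x * \<bar>x\<bar> powr \<gamma>"
definition "integrand x = (gaussian' x + \<gamma> * gaussian x / x) * \<bar>x\<bar> powr \<gamma>"

lemma primitive_DERIV: "x \<noteq> 0 \<Longrightarrow> (primitive has_real_derivative integrand x) (at x)"
  unfolding primitive_def[abs_def] integrand_def
  by (rule DERIV_cong[OF DERIV_mult[OF gaussian_DERIV has_real_derivative_abs_powr]]) (auto simp: field_simps)

lemma gaussian'_eq: "gaussian' x = poly (pderiv p - [:-t, 2:] * p) (x + t) * exp (- x\<^sup>2 - t * x)"
  unfolding gaussian'_def by (simp add: algebra_simps)

lemma gaussian_bound:
  assumes "b \<ge> 0"
  shows "\<exists>K\<ge>0. \<forall>x. \<bar>gaussian x\<bar> \<le> K * exp (- b * \<bar>x\<bar>)"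
    "\<exists>K\<ge>0. \<forall>x. \<bar>gaussian' x\<bar> \<le> K * exp (- b * \<bar>x\<bar>)"
proof -
  have "\<exists>K\<ge>0. \<forall>x. \<bar>poly q (x + t) * exp (- x\<^sup>2 - t * x)\<bar> \<le> K * exp (- b * \<bar>x\<bar>)" for q
  proof -
    obtain K where "K \<ge> 0" "\<And>s x. \<bar>s\<bar> \<le> \<bar>t\<bar> \<Longrightarrow> \<bar>poly q (x + s)\<bar> * exp (- x\<^sup>2 - s * x) \<le> K * exp (- b * \<bar>x\<bar>)"
      using poly_shift_exp_bound[OF assms, of "\<bar>t\<bar>" q] by blast
    then show ?thesis by (intro exI[of _ K]) (simp add: abs_mult)
  qed
  from this[of p] this[of "pderiv p - [:-t, 2:] * p"] show
    "\<exists>K\<ge>0. \<forall>x. \<bar>gaussian x\<bar> \<le> K * exp (- b * \<bar>x\<bar>)"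
    "\<exists>K\<ge>0. \<forall>x. \<bar>gaussian' x\<bar> \<le> K * exp (- b * \<bar>x\<bar>)"
    unfolding gaussian'_eq gaussian_def .
qed

lemma integrable_powr_bounded:
  assumes "\<And>x. \<bar>f x\<bar> \<le> K * exp (- \<bar>x\<bar>)" and [measurable]: "f \<in> borel_measurable borel"
  shows "integrable lborel (\<lambda>x. f x * \<bar>x\<bar> powr \<gamma>)"
proof (rule Bochner_Integration.integrable_bound[OF integrable_envelope[of K]])
  show "AE x in lborel. norm (f x * \<bar>x\<bar> powr \<gamma>) \<le> norm (K * (exp (- \<bar>x\<bar>) * \<bar>x\<bar> powr \<gamma>))"
  proof (rule AE_I2)
    fix x
    have "\<bar>f x\<bar> * \<bar>x\<bar> powr \<gamma> \<le> (K * exp (- \<bar>x\<bar>)) * \<bar>x\<bar> powr \<gamma>"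
      using assms(1) by (intro mult_right_mono) auto
    moreover have "\<bar>f x * \<bar>x\<bar> powr \<gamma>\<bar> = \<bar>f x\<bar> * \<bar>x\<bar> powr \<gamma>" by (simp add: abs_mult)
    ultimately show "norm (f x * \<bar>x\<bar> powr \<gamma>) \<le> norm (K * (exp (- \<bar>x\<bar>) * \<bar>x\<bar> powr \<gamma>))"
      using abs_ge_self[of "K * (exp (- \<bar>x\<bar>) * \<bar>x\<bar> powr \<gamma>)"] unfolding real_norm_def mult.assoc by linarith
  qed
qed measurable

lemma gaussian_over_x_bound:
  assumes "e > 0" "\<And>x. \<bar>gaussian x\<bar> \<le> K * exp (- \<bar>x\<bar>)" "K \<ge> 0"
  shows "\<bar>indicator {x. \<bar>x\<bar> > e} x * (\<gamma> * gaussian x / x)\<bar> \<le> (\<bar>\<gamma>\<bar> * K / e) * exp (- \<bar>x\<bar>)"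
proof (cases "\<bar>x\<bar> > e")
  case True
  have "\<bar>gaussian x\<bar> / \<bar>x\<bar> \<le> K * exp (- \<bar>x\<bar>) / e"
    using assms True by (intro frac_le) auto
  then have "\<bar>\<gamma>\<bar> * (\<bar>gaussian x\<bar> / \<bar>x\<bar>) \<le> \<bar>\<gamma>\<bar> * (K * exp (- \<bar>x\<bar>) / e)"
    by (intro mult_left_mono) auto
  then show ?thesis using True by (simp add: abs_mult)
next
  case False
  then show ?thesis using assms by simp
qed

lemma truncated_integrable:
  assumes "e > 0"
  shows "integrable lborel (\<lambda>x. indicator {x. \<bar>x\<bar> > e} x * (\<gamma> * gaussian x / x) * \<bar>x\<bar> powr \<gamma>)"
proof -
  obtain K where K: "K \<ge> 0" "\<And>x. \<bar>gaussian x\<bar> \<le> K * exp (- \<bar>x\<bar>)" using gaussian_bound(1)[of 1] by auto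
  show ?thesis
    by (rule integrable_powr_bounded[OF gaussian_over_x_bound[OF assms K(2,1)]]) measurable
qed

lemma gaussian'_integrable: "integrable lborel (\<lambda>x. gaussian' x * \<bar>x\<bar> powr \<gamma>)"
  using gaussian_bound(2)[of 1] integrable_powr_bounded[of gaussian'] by auto

lemma integrand_integrable:
  assumes "e > 0"
  shows "set_integrable lborel {x. \<bar>x\<bar> > e} integrand"
proof -
  have "set_integrable lborel {x. \<bar>x\<bar> > e} (\<lambda>x. gaussian' x * \<bar>x\<bar> powr \<gamma>)"
    unfolding set_integrable_def by (rule integrable_mult_indicator[OF _ gaussian'_integrable]) measurable
  moreover have "set_integrable lborel {x. \<bar>x\<bar> > e} (\<lambda>x. (\<gamma> * gaussian x / x) * \<bar>x\<bar> powr \<gamma>)"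
    using truncated_integrable[OF assms] unfolding set_integrable_def by (simp add: mult.assoc)
  ultimately show ?thesis
    unfolding integrand_def distrib_right by (rule set_integral_add)
qed

lemma primitive_tendsto: "(primitive \<longlongrightarrow> 0) at_infinity"
proof -
  obtain K where K: "K \<ge> 0" "\<And>x. \<bar>gaussian x\<bar> \<le> K * exp (- 2 * \<bar>x\<bar>)" using gaussian_bound(1)[of 2] by auto
  have "((\<lambda>x. K * (exp (- 2 * x) * x powr \<gamma>)) \<longlongrightarrow> 0) at_top" by real_asymp
  then have "((\<lambda>x::real. K * (exp (- 2 * norm x) * norm x powr \<gamma>)) \<longlongrightarrow> 0) at_infinity"
    by (rule filterlim_compose) (rule filterlim_norm_at_top)
  then have "((\<lambda>x::real. K * (exp (- 2 * \<bar>x\<bar>) * \<bar>x\<bar> powr \<gamma>)) \<longlongrightarrow> 0) at_infinity"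
    by (simp only: real_norm_def)
  then show ?thesis
  proof (rule Lim_null_comparison[rotated])
    show "\<forall>\<^sub>F x in at_infinity. norm (primitive x) \<le> K * (exp (- 2 * \<bar>x\<bar>) * \<bar>x\<bar> powr \<gamma>)"
    proof (rule always_eventually, rule allI)
      fix x
      show "norm (primitive x) \<le> K * (exp (- 2 * \<bar>x\<bar>) * \<bar>x\<bar> powr \<gamma>)"
        using mult_right_mono[OF K(2), of "\<bar>x\<bar> powr \<gamma>" x]
        by (simp add: primitive_def abs_mult mult.assoc)
    qed
  qed
qed

lemma integrand_cont: "x \<noteq> 0 \<Longrightarrow> isCont integrand x"
  unfolding integrand_def by (auto intro!: continuous_intros gaussian_cont)

lemma right_integral:
  assumes "e > 0"
  shows "(LINT x:{e<..}|lborel. integrand x) = - primitive e"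
proof -
  have "(LBINT x=ereal e..\<infinity>. integrand x) = 0 - primitive e"
  proof (rule interval_integral_FTC_integrable)
    show "set_integrable lborel (einterval e \<infinity>) integrand"
      by (rule set_integrable_subset[OF integrand_integrable[OF assms]]) (auto simp: einterval_def)
    have "isCont primitive e"
      using primitive_DERIV[of e] assms DERIV_isCont by blast
    then have "(primitive \<longlongrightarrow> primitive e) (at_right e)"
      by (simp add: isCont_def filterlim_at_split)
    then show "((primitive \<circ> real_of_ereal) \<longlongrightarrow> primitive e) (at_right (ereal e))"
      unfolding ereal_tendsto_simps .
    have "(primitive \<longlongrightarrow> 0) at_top" using primitive_tendsto by (rule tendsto_mono[OF at_top_le_at_infinity])
    then show "((primitive \<circ> real_of_ereal) \<longlongrightarrow> 0) (at_left \<infinity>)"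
      unfolding ereal_tendsto_simps .
  qed (use assms in \<open>auto intro!: primitive_DERIV integrand_cont simp: has_real_derivative_iff_has_vector_derivative[symmetric]\<close>)
  then show ?thesis by (simp add: interval_integral_to_infinity_eq)
qed

lemma left_integral:
  assumes "e > 0"
  shows "(LINT x:{..<-e}|lborel. integrand x) = primitive (- e)"
proof -
  have "(LBINT x=-\<infinity>..ereal (- e). integrand x) = primitive (- e) - 0"
  proof (rule interval_integral_FTC_integrable)
    show "set_integrable lborel (einterval (-\<infinity>) (ereal (- e))) integrand"
      by (rule set_integrable_subset[OF integrand_integrable[OF assms]]) (auto simp: einterval_def)
    have "isCont primitive (- e)"
      using primitive_DERIV[of "- e"] assms DERIV_isCont by fastforce
    then have "(primitive \<longlongrightarrow> primitive (- e)) (at_left (- e))"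
      by (simp add: isCont_def filterlim_at_split)
    then show "((primitive \<circ> real_of_ereal) \<longlongrightarrow> primitive (- e)) (at_left (ereal (- e)))"
      unfolding ereal_tendsto_simps .
    have "(primitive \<longlongrightarrow> 0) at_bot" using primitive_tendsto by (rule tendsto_mono[OF at_bot_le_at_infinity])
    then show "((primitive \<circ> real_of_ereal) \<longlongrightarrow> 0) (at_right (-\<infinity>))"
      unfolding ereal_tendsto_simps .
  qed (use assms in \<open>auto intro!: primitive_DERIV integrand_cont simp: has_real_derivative_iff_has_vector_derivative[symmetric]\<close>)
  then show ?thesis by (simp add: interval_lebesgue_integral_def einterval_def lessThan_def)
qed

lemma truncated_integral:
  assumes "e > 0"
  shows "(LINT x|lborel. indicator {x. \<bar>x\<bar> > e} x * (\<gamma> * gaussian x / x * singular_part x)) =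
    A * primitive (- e) - (A + B) * primitive e
    - (LINT x|lborel. indicator {x. \<bar>x\<bar> > e} x * (gaussian' x * singular_part x))"
proof -
  let ?c = "\<lambda>x. A + B * step x" and ?I = "indicator {x. \<bar>x\<bar> > e} :: real \<Rightarrow> real"
  have int1: "integrable lborel (\<lambda>x. ?I x * (\<gamma> * gaussian x / x * singular_part x))"
  proof (rule Bochner_Integration.integrable_bound)
    show "integrable lborel (\<lambda>x. (A + \<bar>B\<bar>) * (?I x * (\<gamma> * gaussian x / x) * \<bar>x\<bar> powr \<gamma>))"
      using truncated_integrable[OF assms] by (rule integrable_mult_right)
    show "AE x in lborel. norm (?I x * (\<gamma> * gaussian x / x * singular_part x)) \<le> norm ((A + \<bar>B\<bar>) * (?I x * (\<gamma> * gaussian x / x) * \<bar>x\<bar> powr \<gamma>))"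
    proof (rule AE_I2)
      fix x
      have "\<bar>?I x * (\<gamma> * gaussian x / x)\<bar> * \<bar>singular_part x\<bar> \<le> \<bar>?I x * (\<gamma> * gaussian x / x)\<bar> * ((A + \<bar>B\<bar>) * \<bar>x\<bar> powr \<gamma>)"
        by (intro mult_left_mono singular_part_bound) simp
      then show "norm (?I x * (\<gamma> * gaussian x / x * singular_part x)) \<le> norm ((A + \<bar>B\<bar>) * (?I x * (\<gamma> * gaussian x / x) * \<bar>x\<bar> powr \<gamma>))"
        using A_nonneg by (simp add: abs_mult mult_ac)
    qed
  qed measurable
  have int2: "integrable lborel (\<lambda>x. ?I x * (gaussian' x * singular_part x))"
    using integrable_mult_indicator[OF _ integrable_shift[of "pderiv p - [:-t, 2:] * p" t], of "{x. \<bar>x\<bar> > e}"]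
    unfolding gaussian'_eq by simp
  have "(LINT x|lborel. ?I x * (\<gamma> * gaussian x / x * singular_part x)) + (LINT x|lborel. ?I x * (gaussian' x * singular_part x))
      = (LINT x|lborel. ?I x * (\<gamma> * gaussian x / x * singular_part x) + ?I x * (gaussian' x * singular_part x))"
    using int1 int2 by (rule Bochner_Integration.integral_add[symmetric])
  also have "\<dots> = (LINT x|lborel. A * (indicator {..<-e} x * integrand x) + (A + B) * (indicator {e<..} x * integrand x))"
    using assms by (intro Bochner_Integration.integral_cong refl)
      (auto simp: indicator_def integrand_def singular_part_def step_def algebra_simps add_divide_distrib)
  also have "\<dots> = A * (LINT x:{..<-e}|lborel. integrand x) + (A + B) * (LINT x:{e<..}|lborel. integrand x)"
  proof -
    have "set_integrable lborel {..<-e} integrand" "set_integrable lborel {e<..} integrand"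
      by (auto intro!: set_integrable_subset[OF integrand_integrable[OF assms]])
    then have "integrable lborel (\<lambda>x. indicator {..<-e} x * integrand x)" "integrable lborel (\<lambda>x. indicator {e<..} x * integrand x)"
      by (simp_all add: set_integrable_def)
    then show ?thesis by (simp add: set_lebesgue_integral_def)
  qed
  finally show ?thesis using assms by (simp add: left_integral right_integral algebra_simps)
qed

lemma truncated_boundary_tendsto:
  "((\<lambda>e. A * primitive (- e) - (A + B) * primitive e + B * e powr \<gamma> * poly p t) \<longlongrightarrow> 0) (at_right 0)"
proof -
  define G where "G e = A * gaussian (- e) - (A + B) * gaussian e + B * gaussian 0" for e
  have "((\<lambda>e. gaussian (- e)) has_real_derivative gaussian' 0 * (- 1)) (at 0)"
    by (rule DERIV_chain2[where f = gaussian]) (auto intro!: derivative_eq_intros gaussian_DERIV)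
  then have "(G has_real_derivative A * (gaussian' 0 * (- 1)) - (A + B) * gaussian' 0) (at 0)"
    unfolding G_def using gaussian_DERIV[of 0]
    by (auto intro!: DERIV_cong[OF DERIV_add[OF DERIV_diff[OF DERIV_cmult DERIV_cmult] DERIV_const]])
  then have "((\<lambda>e. (G e - G 0) / (e - 0)) \<longlongrightarrow> A * (gaussian' 0 * (- 1)) - (A + B) * gaussian' 0) (at_right 0)"
    unfolding has_field_derivative_iff by (rule filterlim_mono) (auto simp: at_within_le_at)
  moreover have "((\<lambda>e. e powr (\<gamma> + 1)) \<longlongrightarrow> 0) (at_right 0)"
    using gamma by real_asymp
  ultimately have "((\<lambda>e. e powr (\<gamma> + 1) * ((G e - G 0) / (e - 0))) \<longlongrightarrow> 0 * (A * (gaussian' 0 * (- 1)) - (A + B) * gaussian' 0)) (at_right 0)"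
    by (intro tendsto_mult)
  moreover have "\<forall>\<^sub>F e in at_right 0. e powr (\<gamma> + 1) * ((G e - G 0) / (e - 0)) =
      A * primitive (- e) - (A + B) * primitive e + B * e powr \<gamma> * poly p t"
    using eventually_at_right_less[of "0::real"]
  proof eventually_elim
    case (elim e)
    have "gaussian 0 = poly p t" by (simp add: gaussian_def)
    with elim show ?case by (simp add: G_def primitive_def powr_add field_simps)
  qed
  ultimately show ?thesis by (subst (asm) tendsto_cong) auto
qed

lemma L_gaussian': "(LINT x|lborel. gaussian' x * singular_part x) = - L t ([:-t, 2:] * p - pderiv p)"
  by (subst L_minus[symmetric]) (simp only: L_shift gaussian'_eq minus_diff_eq)

end

lemma singular_integral_eq: "singular_integral A B \<gamma> t p = L t ([:-t, 2:] * p - pderiv p)"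
proof -
  let ?T = "\<lambda>e. \<gamma> * (LINT y:{y. \<bar>y - t\<bar> > e}|lborel. poly p y * weight A B \<gamma> t y / (y - t))"
  let ?h = "\<lambda>x. gaussian t p x / x * singular_part x"
  have shift: "poly p (t + 1 * x) * weight A B \<gamma> t (t + 1 * x) / (t + 1 * x - t) = ?h x" for x
  proof -
    have "t + 1 * x = x + t" by simp
    then show ?thesis by (simp only:) (simp add: weight_shift gaussian_def)
  qed
  have indicator_shift: "indicator {y. \<bar>y - t\<bar> > e} (t + 1 * x) = (indicator {x. \<bar>x\<bar> > e} x :: real)" for e x
    by (simp add: indicator_def)
  have T: "?T e = (LINT x|lborel. indicator {x. \<bar>x\<bar> > e} x * (\<gamma> * gaussian t p x / x * singular_part x))" for e
  proof -
    have "?T e = \<gamma> * (LINT x|lborel. indicator {x. \<bar>x\<bar> > e} x * ?h x)"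
      unfolding set_lebesgue_integral_def
      by (subst lborel_integral_real_affine[of 1 _ t])
        (simp_all only: shift abs_one scaleR_one indicator_shift real_scaleR_def one_neq_zero not_False_eq_True)
    also have "\<dots> = (LINT x|lborel. \<gamma> * (indicator {x. \<bar>x\<bar> > e} x * ?h x))"
      by (rule integral_mult_right_zero[symmetric])
    finally show ?thesis by (simp add: mult_ac)
  qed
  have "integrable lborel (\<lambda>x. gaussian' t p x * singular_part x)"
    using integrable_shift[of "pderiv p - [:-t, 2:] * p" t] by (simp only: gaussian'_eq)
  then have "((\<lambda>e. A * primitive t p (- e) - (A + B) * primitive t p e + B * e powr \<gamma> * poly p t
      - (LINT x|lborel. indicator {x. \<bar>x\<bar> > e} x * (gaussian' t p x * singular_part x))) \<longlongrightarrow>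
      0 - (LINT x|lborel. gaussian' t p x * singular_part x)) (at_right 0)"
    by (intro tendsto_diff truncated_boundary_tendsto truncated_integral_tendsto)
  moreover have "\<forall>\<^sub>F e in at_right 0. A * primitive t p (- e) - (A + B) * primitive t p e + B * e powr \<gamma> * poly p t
      - (LINT x|lborel. indicator {x. \<bar>x\<bar> > e} x * (gaussian' t p x * singular_part x)) = ?T e + B * e powr \<gamma> * poly p t"
    using eventually_at_right_less[of "0::real"]
  proof eventually_elim
    case (elim e)
    show ?case unfolding T truncated_integral[OF elim] by simp
  qed
  ultimately have lim: "((\<lambda>e. ?T e + B * e powr \<gamma> * poly p t) \<longlongrightarrow> L t ([:-t, 2:] * p - pderiv p)) (at_right 0)"
    by (subst (asm) tendsto_cong) (auto simp: L_gaussian')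
  show ?thesis
  proof (cases "\<gamma> > 0")
    case True
    obtain K where K: "K \<ge> 0" "\<And>x. \<bar>gaussian t p x\<bar> \<le> K * exp (- \<bar>x\<bar>)" using gaussian_bound(1)[of 1 t p] by auto
    have "integrable lborel ?h"
    proof (rule Bochner_Integration.integrable_bound)
      show "integrable lborel (\<lambda>x. K * (A + \<bar>B\<bar>) * (exp (- \<bar>x\<bar>) * \<bar>x\<bar> powr (\<gamma> - 1)))"
        using True by (intro integrable_mult_right integrable_exp_abs_powr) auto
      show "AE x in lborel. norm (?h x) \<le> norm (K * (A + \<bar>B\<bar>) * (exp (- \<bar>x\<bar>) * \<bar>x\<bar> powr (\<gamma> - 1)))"
      proof (rule AE_I2)
        fix x
        have "\<bar>gaussian t p x * singular_part x\<bar> / \<bar>x\<bar> \<le> K * (A + \<bar>B\<bar>) * (exp (- \<bar>x\<bar>) * \<bar>x\<bar> powr \<gamma>) / \<bar>x\<bar>"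
          by (intro divide_right_mono envelope K) simp
        also have "\<dots> = K * (A + \<bar>B\<bar>) * (exp (- \<bar>x\<bar>) * \<bar>x\<bar> powr (\<gamma> - 1))"
          by (cases "x = 0") (auto simp: powr_diff)
        finally show "norm (?h x) \<le> norm (K * (A + \<bar>B\<bar>) * (exp (- \<bar>x\<bar>) * \<bar>x\<bar> powr (\<gamma> - 1)))"
          using K(1) A_nonneg by (simp add: abs_mult)
      qed
    qed measurable
    then have "((\<lambda>e. LINT x|lborel. indicator {x. \<bar>x\<bar> > e} x * (\<gamma> * ?h x)) \<longlongrightarrow> (LINT x|lborel. \<gamma> * ?h x)) (at_right 0)"
      by (intro truncated_integral_tendsto integrable_mult_right)
    moreover have "((\<lambda>e. B * e powr \<gamma> * poly p t) \<longlongrightarrow> B * 0 * poly p t) (at_right 0)"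
    proof (intro tendsto_intros)
      show "((\<lambda>e. e powr \<gamma>) \<longlongrightarrow> 0) (at_right 0)" using True by real_asymp
    qed
    ultimately have "((\<lambda>e. ?T e + B * e powr \<gamma> * poly p t) \<longlongrightarrow> (LINT x|lborel. \<gamma> * ?h x) + B * 0 * poly p t) (at_right 0)"
      unfolding T by (intro tendsto_add) (simp_all add: mult.assoc)
    then have "(LINT x|lborel. \<gamma> * ?h x) = L t ([:-t, 2:] * p - pderiv p)"
      using tendsto_unique[OF trivial_limit_at_right_real lim] by simp
    moreover have "\<gamma> * (LINT y|lborel. poly p y * weight A B \<gamma> t y / (y - t)) = \<gamma> * (LINT x|lborel. ?h x)"
      by (subst lborel_integral_real_affine[of 1 _ t])
        (simp_all only: shift, simp_all)
    moreover have "\<gamma> * (LINT x|lborel. ?h x) = (LINT x|lborel. \<gamma> * ?h x)"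
      by (rule integral_mult_right_zero[symmetric])
    ultimately show ?thesis using True by (simp only: singular_integral_def if_True)
  next
    case False
    then show ?thesis
      using tendsto_Lim[OF trivial_limit_at_right_real lim] by (simp add: singular_integral_def)
  qed
qed

end

section \<open>Families of polynomials\<close>

definition coeff_deriv :: "(real \<Rightarrow> real poly) \<Rightarrow> real poly \<Rightarrow> real \<Rightarrow> bool" where
  "coeff_deriv Q D t \<longleftrightarrow> (\<forall>k. ((\<lambda>s. coeff (Q s) k) has_real_derivative coeff D k) (at t))"

lemma pderiv_sum: "pderiv (\<Sum>i\<in>I. f i) = (\<Sum>i\<in>I. pderiv (f i))"
  by (induction I rule: infinite_finite_induct) (auto simp: pderiv_add)

lemma coeff_deriv_const: "coeff_deriv (\<lambda>s. q) 0 t"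
  by (simp add: coeff_deriv_def)

lemma coeff_deriv_diff: "coeff_deriv Q D t \<Longrightarrow> coeff_deriv Q' D' t \<Longrightarrow> coeff_deriv (\<lambda>s. Q s - Q' s) (D - D') t"
  by (auto simp: coeff_deriv_def intro!: derivative_intros)

lemma coeff_deriv_mult:
  assumes "coeff_deriv Q D t" "coeff_deriv Q' D' t"
  shows "coeff_deriv (\<lambda>s. Q s * Q' s) (D * Q' t + Q t * D') t"
  unfolding coeff_deriv_def
proof
  fix k
  have "((\<lambda>s. \<Sum>i\<le>k. coeff (Q s) i * coeff (Q' s) (k - i)) has_real_derivative
      (\<Sum>i\<le>k. coeff D i * coeff (Q' t) (k - i) + coeff D' (k - i) * coeff (Q t) i)) (at t)"
    using assms by (intro DERIV_sum DERIV_mult) (auto simp: coeff_deriv_def)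
  then show "((\<lambda>s. coeff (Q s * Q' s) k) has_real_derivative coeff (D * Q' t + Q t * D') k) (at t)"
    by (simp add: coeff_mult sum.distrib mult.commute[of "coeff D' _"])
qed

lemma coeff_deriv_smult:
  assumes "(c has_real_derivative d) (at t)" "coeff_deriv Q D t"
  shows "coeff_deriv (\<lambda>s. smult (c s) (Q s)) (smult d (Q t) + smult (c t) D) t"
  unfolding coeff_deriv_def
proof
  fix k
  show "((\<lambda>s. coeff (smult (c s) (Q s)) k) has_real_derivative coeff (smult d (Q t) + smult (c t) D) k) (at t)"
    using DERIV_mult[OF assms(1), of "\<lambda>s. coeff (Q s) k" "coeff D k"] assms(2)
    by (simp add: coeff_deriv_def mult.commute[of "c t"])
qed

lemma coeff_deriv_degree:
  assumes "coeff_deriv Q D t" and "\<And>s. degree (Q s) \<le> n"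
  shows "degree D \<le> n"
proof (rule degree_le, intro allI impI)
  fix k assume "k > n"
  then have "coeff (Q s) k = 0" for s using assms(2)[of s] by (intro coeff_eq_0) linarith
  then have "((\<lambda>s. 0) has_real_derivative coeff D k) (at t)" using assms(1) by (auto simp: coeff_deriv_def dest!: spec[of _ k])
  then show "coeff D k = 0" by (rule DERIV_unique) simp
qed

context jump_weight
begin

lemma L_monom_sum:
  assumes "degree p \<le> n"
  shows "L t p = (\<Sum>k\<le>n. coeff p k * L t (monom 1 k))"
proof -
  have "L t p = L t (\<Sum>k\<le>n. monom (coeff p k) k)" using poly_as_sum_of_monoms'[OF assms] by simp
  also have "\<dots> = (\<Sum>k\<le>n. L t (smult (coeff p k) (monom 1 k)))" by (simp add: L_sum smult_monom)
  finally show ?thesis by (simp add: L_smult)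
qed

lemma L_has_derivative_family:
  assumes Q: "coeff_deriv Q D t" and deg: "\<And>s. degree (Q s) \<le> n"
  shows "((\<lambda>s. L s (Q s)) has_real_derivative L t (D + pderiv (Q t) + [:t, -1:] * Q t)) (at t)"
proof -
  let ?d = "\<lambda>p. pderiv p + [:t, -1:] * p"
  have "((\<lambda>s. \<Sum>k\<le>n. coeff (Q s) k * L s (monom 1 k)) has_real_derivative
      (\<Sum>k\<le>n. coeff D k * L t (monom 1 k) + L t (?d (monom 1 k)) * coeff (Q t) k)) (at t)"
    using Q by (intro DERIV_sum DERIV_mult L_has_derivative) (auto simp: coeff_deriv_def)
  also have "(\<lambda>s. \<Sum>k\<le>n. coeff (Q s) k * L s (monom 1 k)) = (\<lambda>s. L s (Q s))"
    using L_monom_sum[OF deg] by simp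
  also have "(\<Sum>k\<le>n. coeff D k * L t (monom 1 k) + L t (?d (monom 1 k)) * coeff (Q t) k) =
      L t D + (\<Sum>k\<le>n. L t (?d (monom (coeff (Q t) k) k)))"
  proof -
    have "?d (monom (coeff (Q t) k) k) = smult (coeff (Q t) k) (?d (monom 1 k))" for k
      using pderiv_smult[of "coeff (Q t) k" "monom 1 k"] mult_smult_right[of "[:t, -1:]" "coeff (Q t) k" "monom 1 k"]
      by (simp add: smult_monom smult_add_right)
    then show ?thesis
      by (simp only: L_smult) (simp add: sum.distrib mult.commute L_monom_sum[OF coeff_deriv_degree[OF Q deg]])
  qed
  also have "(\<Sum>k\<le>n. L t (?d (monom (coeff (Q t) k) k))) = L t (?d (\<Sum>k\<le>n. monom (coeff (Q t) k) k))"
    by (simp only: L_sum[symmetric] pderiv_sum sum.distrib sum_distrib_left)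
  also have "(\<Sum>k\<le>n. monom (coeff (Q t) k) k) = Q t" by (rule poly_as_sum_of_monoms'[OF deg])
  finally show ?thesis by (simp only: L_add add.assoc)
qed

end

section \<open>Orthogonal polynomials\<close>

locale orthogonal_family = jump_weight +
  fixes P :: "real \<Rightarrow> nat \<Rightarrow> real poly" and \<alpha> \<beta> :: "nat \<Rightarrow> real \<Rightarrow> real"
  assumes orth: "\<And>t. monic_orthogonal (weight A B \<gamma> t) (P t)"
    and rec: "\<And>t. three_term_recurrence (P t) (\<lambda>n. \<alpha> n t) (\<lambda>n. \<beta> n t)"
begin

lemma degree_P [simp]: "degree (P t n) = n" and lead_P: "coeff (P t n) n = 1"
  using orth[of t] by (auto simp: monic_orthogonal_def dest: spec[of _ n])

lemma L_orth: "i \<noteq> j \<Longrightarrow> L t (P t i * P t j) = 0"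
  using orth[of t] unfolding monic_orthogonal_def L_def by (simp add: mult_ac)

definition h :: "nat \<Rightarrow> real \<Rightarrow> real" where
  "h n t = L t (P t n * P t n)"

lemma sq_norm_eq: "sq_norm (weight A B \<gamma> t) (P t) n = h n t"
  by (simp add: sq_norm_def h_def L_def power2_eq_square)

lemma h_pos: "h n t > 0"
  unfolding h_def using lead_P[of t n] by (intro L_square_pos) auto

lemma L_lower_degree: "degree q \<le> n \<Longrightarrow> coeff q n = 0 \<Longrightarrow> L t (q * P t n) = 0"
proof (induction "degree q" arbitrary: q rule: less_induct)
  case less
  show ?case
  proof (cases "q = 0")
    case False
    define d where "d = degree q"
    have "d < n" using less.prems False by (metis d_def le_neq_implies_less leading_coeff_0_iff)
    define r where "r = q - smult (coeff q d) (P t d)"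
    have r: "degree r \<le> d" "coeff r d = 0"
      by (auto simp: r_def d_def lead_P intro!: degree_diff_le)
    have "L t (r * P t n) = 0"
    proof (cases "d = 0")
      case True
      then have "r = 0" using r by (metis le_zero_eq leading_coeff_0_iff)
      then show ?thesis by simp
    next
      case False
      then have "degree r < d" using r by (metis le_neq_implies_less degree_0 leading_coeff_0_iff)
      then show ?thesis using \<open>d < n\<close> by (intro less.hyps) (auto simp: d_def coeff_eq_0)
    qed
    moreover have "q * P t n = r * P t n + smult (coeff q d) (P t d * P t n)"
      by (simp add: r_def algebra_simps)
    ultimately show ?thesis using L_orth[of d n t] \<open>d < n\<close> by (simp add: L_linear)
  qed simp
qed

lemma L_times_P:
  assumes "degree q \<le> n"
  shows "L t (q * P t n) = coeff q n * h n t"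
proof -
  have "L t ((q - smult (coeff q n) (P t n)) * P t n) = 0"
    using assms by (intro L_lower_degree degree_diff_le) (auto simp: lead_P)
  then show ?thesis by (simp add: algebra_simps L_linear h_def)
qed

lemma recurrence:
  "[:0, 1:] * P t n = P t (Suc n) + smult (\<alpha> n t) (P t n) + (if n = 0 then 0 else smult (\<beta> n t) (P t (n - 1)))"
  using rec[of t] unfolding three_term_recurrence_def by blast

lemma alpha_h: "L t ([:0, 1:] * P t n * P t n) = \<alpha> n t * h n t"
  unfolding recurrence by (auto simp: algebra_simps L_linear L_orth h_def)

lemma beta_h:
  assumes "n > 0"
  shows "h n t = \<beta> n t * h (n - 1) t"
proof -
  have "L t ([:0, 1:] * P t n * P t (n - 1)) = \<beta> n t * h (n - 1) t"
    unfolding recurrence using assms by (simp add: algebra_simps L_linear L_orth h_def)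
  moreover have "L t (([:0, 1:] * P t (n - 1)) * P t n) = h n t"
    using assms by (subst L_times_P) (auto simp: degree_pCons_eq_if coeff_pCons lead_P split: nat.splits)
  ultimately show ?thesis by (simp add: mult_ac)
qed

lemma alpha_eq: "\<alpha> n t = L t ([:0, 1:] * P t n * P t n) / h n t"
  using alpha_h[of t n] h_pos[of n t] by simp

lemma beta_eq: "n > 0 \<Longrightarrow> \<beta> n t = h n t / h (n - 1) t"
  using beta_h[of n t] h_pos[of "n - 1" t] by simp

lemma h_deriv:
  assumes "coeff_deriv (\<lambda>s. P s n) D t"
  shows "(h n has_real_derivative L t ((D * P t n + P t n * D) + pderiv (P t n * P t n) + [:t, -1:] * (P t n * P t n))) (at t)"
  unfolding h_def[abs_def]
  by (rule L_has_derivative_family[OF coeff_deriv_mult[OF assms assms], where n = "n + n"])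
    (use degree_mult_le[of "P _ n" "P _ n"] in simp)

lemma alpha_deriv_exists:
  assumes "coeff_deriv (\<lambda>s. P s n) D t"
  shows "\<exists>d. (\<alpha> n has_real_derivative d) (at t)"
proof -
  let ?Q = "\<lambda>s. [:0, 1:] * P s n * P s n"
  have "degree (?Q s) \<le> 1 + n + n" for s
    using degree_mult_le[of "[:0, 1:] * P s n" "P s n"] degree_mult_le[of "[:0, 1::real:]" "P s n"] by simp
  then have "\<exists>d. ((\<lambda>s. L s (?Q s)) has_real_derivative d) (at t)"
    using L_has_derivative_family[OF coeff_deriv_mult[OF coeff_deriv_mult[OF coeff_deriv_const assms] assms]] by blast
  then obtain d where "((\<lambda>s. L s (?Q s)) has_real_derivative d) (at t)" ..
  from DERIV_divide[OF this h_deriv[OF assms]] show ?thesis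
    unfolding alpha_eq[abs_def] using h_pos[of n t] by auto
qed

lemma beta_deriv_exists:
  assumes "n > 0" "coeff_deriv (\<lambda>s. P s n) D t" "coeff_deriv (\<lambda>s. P s (n - 1)) D' t"
  shows "\<exists>d. (\<beta> n has_real_derivative d) (at t)"
  using DERIV_divide[OF h_deriv[OF assms(2)] h_deriv[OF assms(3)]] h_pos[of "n - 1" t]
  unfolding beta_eq[OF assms(1), abs_def] by auto

lemma P_0: "P t 0 = 1"
  using degree_eq_zeroE[OF degree_P[of t 0]] lead_P[of t 0] by (metis coeff_pCons_0 one_pCons)

lemma P_deriv_exists: "\<exists>D. coeff_deriv (\<lambda>s. P s n) D t"
proof (induction n rule: less_induct)
  case (less n)
  show ?case
  proof (cases n)
    case 0
    then show ?thesis using coeff_deriv_const[of 1 t] by (auto simp: P_0)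
  next
    case (Suc m)
    obtain D where D: "coeff_deriv (\<lambda>s. P s m) D t" using less Suc by blast
    obtain a where a: "(\<alpha> m has_real_derivative a) (at t)" using alpha_deriv_exists[OF D] ..
    note main = coeff_deriv_diff[OF coeff_deriv_mult[OF coeff_deriv_const D] coeff_deriv_smult[OF a D], of "[:0, 1:]"]
    show ?thesis
    proof (cases "m = 0")
      case True
      have "P s n = [:0, 1:] * P s m - smult (\<alpha> m s) (P s m)" for s
        using recurrence[of s m] True Suc by simp
      then have eq: "(\<lambda>s. P s n) = (\<lambda>s. [:0, 1:] * P s m - smult (\<alpha> m s) (P s m))" ..
      show ?thesis unfolding eq by (rule exI, rule main)
    next
      case False
      obtain D' where D': "coeff_deriv (\<lambda>s. P s (m - 1)) D' t"
        using less[of "m - 1"] Suc by (metis diff_less_Suc)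
      obtain b where b: "(\<beta> m has_real_derivative b) (at t)"
        using beta_deriv_exists[OF _ D D'] False by auto
      have "P s n = [:0, 1:] * P s m - smult (\<alpha> m s) (P s m) - smult (\<beta> m s) (P s (m - 1))" for s
        using recurrence[of s m] False Suc by simp
      then have eq: "(\<lambda>s. P s n) = (\<lambda>s. [:0, 1:] * P s m - smult (\<alpha> m s) (P s m) - smult (\<beta> m s) (P s (m - 1)))" ..
      show ?thesis unfolding eq by (rule exI, rule coeff_deriv_diff[OF main coeff_deriv_smult[OF b D']])
    qed
  qed
qed

definition dP :: "nat \<Rightarrow> real \<Rightarrow> real poly" where
  "dP n t = (SOME D. coeff_deriv (\<lambda>s. P s n) D t)"

lemma dP: "coeff_deriv (\<lambda>s. P s n) (dP n t) t"
  unfolding dP_def by (rule someI_ex[OF P_deriv_exists])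

lemma degree_dP: "degree (dP n t) \<le> n"
  using coeff_deriv_degree[OF dP] by simp

lemma coeff_dP: "coeff (dP n t) n = 0"
proof -
  have "((\<lambda>s. 1) has_real_derivative coeff (dP n t) n) (at t)"
    using dP[of n t] by (auto simp: coeff_deriv_def lead_P dest!: spec[of _ n])
  then show ?thesis by (rule DERIV_unique) simp
qed

lemma L_P_low: "degree q < n \<Longrightarrow> L t (q * P t n) = 0"
  by (rule L_lower_degree) (auto simp: coeff_eq_0)

lemma L_pderiv_P_sq: "L t (pderiv (P t n * P t n)) = 0"
proof -
  have "L t (P t n * pderiv (P t n)) = 0"
    using L_lower_degree[of "pderiv (P t n)" n t]
    by (simp add: mult.commute degree_pderiv coeff_pderiv coeff_eq_0)
  then show ?thesis by (simp only: pderiv_mult L_add)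
qed

lemma h_has_derivative: "(h n has_real_derivative (t - \<alpha> n t) * h n t) (at t)"
proof -
  have "L t (dP n t * P t n) = 0" by (rule L_lower_degree[OF degree_dP coeff_dP])
  moreover have "[:t, -1:] * (P t n * P t n) = smult t (P t n * P t n) - [:0, 1:] * P t n * P t n"
    by (simp add: algebra_simps)
  ultimately show ?thesis using h_deriv[OF dP, of n t] alpha_h[of t n]
    by (simp only: L_linear L_pderiv_P_sq h_def mult.commute[of "P t n" "dP n t"]) (simp add: algebra_simps)
qed

lemma beta_has_derivative:
  assumes "n > 0"
  shows "(\<beta> n has_real_derivative \<beta> n t * (\<alpha> (n - 1) t - \<alpha> n t)) (at t)"
proof -
  have "((\<lambda>s. h n s / h (n - 1) s) has_real_derivative \<beta> n t * (\<alpha> (n - 1) t - \<alpha> n t)) (at t)"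
    using h_pos[of "n - 1" t] beta_h[OF assms, of t]
    by (intro DERIV_cong[OF DERIV_divide[OF h_has_derivative h_has_derivative]]) (auto simp: field_simps)
  then show ?thesis by (subst beta_eq[OF assms, abs_def])
qed

lemma L_pderiv_P_P:
  assumes "n > 0"
  shows "L t (pderiv (P t n * P t (n - 1))) = n * h (n - 1) t"
proof -
  have "L t (pderiv (P t n) * P t (n - 1)) = n * h (n - 1) t"
    using assms lead_P[of t n] by (subst L_times_P) (auto simp: degree_pderiv coeff_pderiv)
  moreover have "L t (pderiv (P t (n - 1)) * P t n) = 0"
    using assms by (intro L_P_low) (auto simp: degree_pderiv)
  ultimately show ?thesis by (simp add: pderiv_mult L_add mult.commute)
qed

lemma L_x_P_P:
  assumes "n > 0"
  shows "L t ([:0, 1:] * (P t n * P t (n - 1))) = h n t"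
proof -
  have "[:0, 1:] * (P t n * P t (n - 1)) = ([:0, 1:] * P t (n - 1)) * P t n" by (simp add: mult_ac)
  then show ?thesis
    using assms by (simp only:, subst L_times_P) (auto simp: degree_pCons_eq_if coeff_pCons lead_P split: nat.splits)
qed

lemma coeff_dP_pred:
  assumes "n > 0"
  shows "coeff (dP n t) (n - 1) = \<beta> n t - n"
proof -
  let ?D = "dP n t * P t (n - 1) + P t n * dP (n - 1) t" and ?Q = "P t n * P t (n - 1)"
  have "((\<lambda>s. L s (P s n * P s (n - 1))) has_real_derivative L t (?D + pderiv ?Q + [:t, -1:] * ?Q)) (at t)"
    by (rule L_has_derivative_family[OF coeff_deriv_mult[OF dP dP], where n = "n + (n - 1)"])
      (use degree_mult_le[of "P _ n" "P _ (n - 1)"] in simp)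
  then have "((\<lambda>s. 0) has_real_derivative L t (?D + pderiv ?Q + [:t, -1:] * ?Q)) (at t)"
    using assms by (simp add: L_orth)
  then have "L t (?D + pderiv ?Q + [:t, -1:] * ?Q) = 0"
    by (rule DERIV_unique) simp
  moreover have "[:t, -1:] * ?Q = smult t ?Q - [:0, 1:] * ?Q" by simp
  moreover have "L t (dP n t * P t (n - 1)) = coeff (dP n t) (n - 1) * h (n - 1) t"
  proof (rule L_times_P, rule degree_le, intro allI impI)
    fix i assume "i > n - 1"
    then have "i \<ge> n" by simp
    then show "coeff (dP n t) i = 0"
      using coeff_dP[of n t] degree_dP[of n t] by (cases "i = n") (auto intro!: coeff_eq_0)
  qed
  moreover have "L t (P t n * dP (n - 1) t) = 0"
    using L_P_low[of "dP (n - 1) t" n t] degree_dP[of "n - 1" t] assms by (simp add: mult.commute)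
  ultimately have "coeff (dP n t) (n - 1) * h (n - 1) t + n * h (n - 1) t - h n t = 0"
    using assms by (simp only: L_linear L_pderiv_P_P L_x_P_P) (simp add: L_orth)
  then have "(coeff (dP n t) (n - 1) - (\<beta> n t - n)) * h (n - 1) t = 0"
    using beta_h[OF assms, of t] by (simp add: algebra_simps)
  then show ?thesis using h_pos[of "n - 1" t] by simp
qed

lemma alpha_coeff: "\<alpha> n t = (if n = 0 then 0 else coeff (P t n) (n - 1)) - coeff (P t (Suc n)) n"
proof -
  have "coeff ([:0, 1:] * P t n) n = coeff (P t (Suc n)) n + \<alpha> n t"
    unfolding recurrence by (auto simp: lead_P coeff_eq_0)
  then show ?thesis by (cases n) (auto simp: coeff_pCons)
qed

lemma alpha_has_derivative:
  "(\<alpha> n has_real_derivative (if n = 0 then 0 else \<beta> n t) - \<beta> (Suc n) t + 1) (at t)"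
proof -
  have 1: "((\<lambda>s. coeff (P s (Suc n)) n) has_real_derivative \<beta> (Suc n) t - Suc n) (at t)"
    using dP[of "Suc n" t] coeff_dP_pred[of "Suc n" t] by (auto simp: coeff_deriv_def dest!: spec[of _ n])
  have 2: "((\<lambda>s. if n = 0 then 0 else coeff (P s n) (n - 1)) has_real_derivative (if n = 0 then 0 else \<beta> n t - n)) (at t)"
    using dP[of n t] coeff_dP_pred[of n t] by (auto simp: coeff_deriv_def dest!: spec[of _ "n - 1"])
  show ?thesis
    unfolding alpha_coeff[of n, abs_def] by (rule DERIV_cong[OF DERIV_diff[OF 2 1]]) auto
qed

lemma R_aux_eq: "R_aux A B \<gamma> P n t = 2 * \<alpha> n t - t"
proof -
  have "[:-t, 2:] * (P t n * P t n) = smult 2 ([:0, 1:] * P t n * P t n) - smult t (P t n * P t n)"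
    by (simp add: algebra_simps)
  then have "singular_integral A B \<gamma> t ((P t n)\<^sup>2) = (2 * \<alpha> n t - t) * h n t"
    by (simp only: singular_integral_eq power2_eq_square L_linear L_pderiv_P_sq alpha_h)
      (simp add: h_def algebra_simps)
  then show ?thesis using h_pos[of n t] by (simp add: R_aux_def sq_norm_eq)
qed

lemma r_aux_eq: "r_aux A B \<gamma> P n t = (if n = 0 then 0 else 2 * \<beta> n t - n)"
proof (cases "n = 0")
  case False
  then have n: "n > 0" by simp
  let ?Q = "P t n * P t (n - 1)"
  have "[:-t, 2:] * ?Q = smult 2 ([:0, 1:] * ?Q) - smult t ?Q" by simp
  then have "singular_integral A B \<gamma> t ?Q = 2 * h n t - n * h (n - 1) t"
    using n by (simp only: singular_integral_eq L_linear L_pderiv_P_P L_x_P_P) (simp add: L_orth)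
  then show ?thesis using n h_pos[of "n - 1" t] beta_eq[OF n, of t]
    by (simp add: r_aux_def sq_norm_eq field_simps)
qed (simp add: r_aux_def)

end

theorem theorem4p1:
  fixes A B \<gamma> :: real
    and P :: "real \<Rightarrow> nat \<Rightarrow> real poly"
    and \<alpha> \<beta> :: "nat \<Rightarrow> real \<Rightarrow> real"
  assumes "A \<ge> 0" and "A + B \<ge> 0" and "\<not> (A = 0 \<and> B = 0)"
    and "\<gamma> > -1"
    and "\<And>t. monic_orthogonal (weight A B \<gamma> t) (P t)"
    and "\<And>t. three_term_recurrence (P t) (\<lambda>n. \<alpha> n t) (\<lambda>n. \<beta> n t)"
  shows "(\<forall>n\<ge>1. \<forall>t. (\<beta> n has_real_derivative
            \<beta> n t / 2 * (R_aux A B \<gamma> P (n - 1) t - R_aux A B \<gamma> P n t)) (at t))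
       \<and> (\<forall>n. \<forall>t. (\<alpha> n has_real_derivative
            1 / 2 * (r_aux A B \<gamma> P n t - r_aux A B \<gamma> P (n + 1) t + 1)) (at t))"
proof -
  interpret orthogonal_family A B \<gamma> P \<alpha> \<beta>
    using assms by unfold_locales auto
  show ?thesis
  proof (intro conjI allI impI)
    fix n :: nat and t :: real
    assume "n \<ge> 1"
    then have "n > 0" by simp
    from beta_has_derivative[OF this, of t]
    show "(\<beta> n has_real_derivative \<beta> n t / 2 * (R_aux A B \<gamma> P (n - 1) t - R_aux A B \<gamma> P n t)) (at t)"
      by (rule DERIV_cong) (simp add: R_aux_eq algebra_simps)
  next
    fix n :: nat and t :: real
    show "(\<alpha> n has_real_derivative 1 / 2 * (r_aux A B \<gamma> P n t - r_aux A B \<gamma> P (n + 1) t + 1)) (at t)"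
      by (rule DERIV_cong[OF alpha_has_derivative]) (auto simp: r_aux_eq field_simps)
  qed
qed

end
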